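(* For every integer $d\geqslant 1$ there exists a finite kei $K=(X,\triangleright)$ such that the edge-coloured multigraph $G_K$ has a connected component, with vertex set $C\subseteq X$, for which $G_K[C]$ has diameter $d$, $|C|=2^d$, and the maximum over all colours $k\in X$ of the number of edges of colour $k$ in $G_K[C]$ is exactly $2^{d-1}$.
   Context: A kei is a pair $(X,\triangleright)$ with $X$ a non-empty set and $\triangleright:X\times X\to X$ a binary operation such that: for each $y\in X$ the map $x\mapsto x\triangleright y$ is a bijection on $X$; $(x\triangleright y)\triangleright z=(x\triangleright z)\triangleright(y\triangleright z)$ for all $x,y,z\in X$; $x\triangleright x=x$ for all $x\in X$; and $(x\triangleright y)\triangleright y=x$ for all $x,y\in X$. For $y\in X$ write $f_y:X\to X$ for the involution $(x)f_y=x\triangleright y$ (maps act on the right). For a kei $K=(X,\triangleright)$, $G_K$ is the loopless edge-coloured multigraph with vertex set $X$ and colour set $X$, in which, for each $y\in X$, there is exactly one edge of colour $y$ between $u$ and $v$ if and only if $u\neq v$ and $(u)f_y=v$. Edges of different colours between the same two vertices are different edges. Diameter refers to the usual graph distance, ignoring colours and multiplicities. *)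

theory Defs
  imports Main "HOL-Library.Extended_Nat"
begin

locale kei =
  fixes X :: "'a set"
    and op :: "'a \<Rightarrow> 'a \<Rightarrow> 'a"  (infixl "\<triangleright>" 70)
  assumes nonempty: "X \<noteq> {}"
    and closed: "\<lbrakk>x \<in> X; y \<in> X\<rbrakk> \<Longrightarrow> x \<triangleright> y \<in> X"
    and bij: "y \<in> X \<Longrightarrow> bij_betw (\<lambda>x. x \<triangleright> y) X X"
    and self_distrib:
      "\<lbrakk>x \<in> X; y \<in> X; z \<in> X\<rbrakk> \<Longrightarrow> (x \<triangleright> y) \<triangleright> z = (x \<triangleright> z) \<triangleright> (y \<triangleright> z)"
    and idem: "x \<in> X \<Longrightarrow> x \<triangleright> x = x"
    and involutory: "\<lbrakk>x \<in> X; y \<in> X\<rbrakk> \<Longrightarrow> (x \<triangleright> y) \<triangleright> y = x"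

text \<open>
  An edge is a pair of its colour and its set of endpoints: edges of different colours between
  the same two vertices are different, and there is at most one edge of each colour between
  two given vertices.
\<close>

record ('v, 'c) coloured_multigraph =
  vertices :: "'v set"
  colours :: "'c set"
  edges :: "('c \<times> 'v set) set"

definition kei_graph :: "'a set \<Rightarrow> ('a \<Rightarrow> 'a \<Rightarrow> 'a) \<Rightarrow> ('a, 'a) coloured_multigraph" where
  "kei_graph X op =
    \<lparr>vertices = X, colours = X,
     edges = {(y, {u, v}) | y u v. y \<in> X \<and> u \<in> X \<and> v \<in> X \<and> u \<noteq> v \<and> op u y = v}\<rparr>"

definition induced_subgraph ::
    "('v, 'c) coloured_multigraph \<Rightarrow> 'v set \<Rightarrow> ('v, 'c) coloured_multigraph" where
  "induced_subgraph G C =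
    \<lparr>vertices = vertices G \<inter> C, colours = colours G,
     edges = {(k, e) \<in> edges G. e \<subseteq> C}\<rparr>"

definition adjacent :: "('v, 'c) coloured_multigraph \<Rightarrow> 'v \<Rightarrow> 'v \<Rightarrow> bool" where
  "adjacent G u v \<longleftrightarrow> (\<exists>k \<in> colours G. (k, {u, v}) \<in> edges G)"

definition walk_between :: "('v, 'c) coloured_multigraph \<Rightarrow> 'v \<Rightarrow> 'v list \<Rightarrow> 'v \<Rightarrow> bool" where
  "walk_between G u p v \<longleftrightarrow>
    p \<noteq> [] \<and> set p \<subseteq> vertices G \<and> hd p = u \<and> last p = v \<and> successively (adjacent G) p"

definition graph_component :: "('v, 'c) coloured_multigraph \<Rightarrow> 'v set \<Rightarrow> bool" where
  "graph_component G C \<longleftrightarrow> (\<exists>u \<in> vertices G. C = {v. \<exists>p. walk_between G u p v})"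

text \<open>
  A walk is given by its vertices, so it has one edge fewer than its list has entries. Distances
  and diameters are extended naturals; the distance between vertices not joined by a walk is
  \<open>\<infinity>\<close>.
\<close>

definition graph_distance :: "('v, 'c) coloured_multigraph \<Rightarrow> 'v \<Rightarrow> 'v \<Rightarrow> enat" where
  "graph_distance G u v = (INF p \<in> {p. walk_between G u p v}. enat (length p - 1))"

definition graph_diameter :: "('v, 'c) coloured_multigraph \<Rightarrow> enat" where
  "graph_diameter G = (SUP u \<in> vertices G. SUP v \<in> vertices G. graph_distance G u v)"

definition edges_of_colour :: "('v, 'c) coloured_multigraph \<Rightarrow> 'c \<Rightarrow> ('c \<times> 'v set) set" where
  "edges_of_colour G k = {e \<in> edges G. fst e = k}"

end

(*
  Take the d-dimensional cube together with d further points, one for each direction. The point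
  of direction i reflects the cube in that direction and fixes the further points, and every
  point of the cube acts trivially. Reflections commute, so this is a kei. The cube is a
  component, it carries the usual cube graph (of diameter d), and the edges of a colour
  form the perfect matching of the cube in that direction.
*)
theory Submission
  imports Defs
begin

section \<open>Bit strings of length \<open>d\<close> and bit flips\<close>

text \<open>Being below \<open>2 ^ d\<close> means that truncation to \<open>d\<close> bits changes
  nothing. This allows membership in the cube to be checked bit by bit.\<close>

lemma nat_less_exp_iff_bit: "(n :: nat) < 2 ^ d \<longleftrightarrow> (\<forall>i\<ge>d. \<not> bit n i)"
proof -
  have "n < 2 ^ d \<longleftrightarrow> take_bit d n = n"
    by (simp add: take_bit_nat_eq_self_iff)
  also have "\<dots> \<longleftrightarrow> (\<forall>i\<ge>d. \<not> bit n i)"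
    unfolding bit_eq_iff bit_take_bit_iff by (metis not_le possible_bit_nat)
  finally show ?thesis .
qed

lemma flip_bit_less_exp: "(n :: nat) < 2 ^ d \<Longrightarrow> i < d \<Longrightarrow> flip_bit i n < 2 ^ d"
  by (auto simp: nat_less_exp_iff_bit bit_flip_bit_iff)

lemma flip_bit_flip_bit [simp]: "flip_bit i (flip_bit i n) = (n :: nat)"
  by (auto simp: bit_eq_iff bit_flip_bit_iff)

lemma flip_bit_commute: "flip_bit i (flip_bit j n) = flip_bit j (flip_bit i n)" for n :: nat
  by (auto simp: bit_eq_iff bit_flip_bit_iff)

lemma flip_bit_neq [simp]: "flip_bit i n \<noteq> n" for n :: nat
  by (auto simp: bit_eq_iff bit_flip_bit_iff)

text \<open>Flipping bit \<open>i\<close> is a bijection between the numbers with that bit clear and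
  those with it set, so each kind makes up half of the \<open>2 ^ d\<close> numbers.\<close>

lemma card_less_exp_not_bit:
  assumes "i < d"
  shows "card {n :: nat. n < 2 ^ d \<and> \<not> bit n i} = 2 ^ (d - 1)"
proof -
  let ?A = "{n :: nat. n < 2 ^ d \<and> \<not> bit n i}" and ?B = "{n :: nat. n < 2 ^ d \<and> bit n i}"
  have "bij_betw (flip_bit i) ?A ?B"
    using assms by (intro bij_betw_byWitness[where f' = "flip_bit i"])
      (auto simp: flip_bit_less_exp bit_flip_bit_iff)
  then have "card ?A = card ?B"
    by (rule bij_betw_same_card)
  moreover have "{..<2 ^ d} = ?A \<union> ?B"
    by auto
  then have "card {..<2 ^ d :: nat} = card ?A + card ?B"
    by (simp only:) (rule card_Un_disjoint, auto)
  ultimately have "2 * card ?A = 2 ^ d"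
    by simp
  also have "(2 :: nat) ^ d = 2 * 2 ^ (d - 1)"
    using assms by (cases d) auto
  finally show ?thesis
    by simp
qed

section \<open>The kei on the cube and its directions\<close>

text \<open>
  The numbers below \<open>2 ^ d\<close> are the vertices of the cube, and \<open>2 ^ d + i\<close> is the point that
  reflects the cube in direction \<open>i\<close>.
\<close>

definition cube_points :: "nat \<Rightarrow> nat set" where
  "cube_points d = {..<2 ^ d + d}"

definition cube_op :: "nat \<Rightarrow> nat \<Rightarrow> nat \<Rightarrow> nat" where
  "cube_op d x y = (if x < 2 ^ d \<and> 2 ^ d \<le> y then flip_bit (y - 2 ^ d) x else x)"

abbreviation cube_graph :: "nat \<Rightarrow> (nat, nat) coloured_multigraph" where
  "cube_graph d \<equiv> induced_subgraph (kei_graph (cube_points d) (cube_op d)) {..<2 ^ d}"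

lemma cube_op_less_iff:
  assumes "y \<in> cube_points d"
  shows "cube_op d x y < 2 ^ d \<longleftrightarrow> x < 2 ^ d"
  using assms by (auto simp: cube_op_def cube_points_def intro!: flip_bit_less_exp)

lemma cube_op_cube_op [simp]:
  assumes "y \<in> cube_points d"
  shows "cube_op d (cube_op d x y) y = x"
proof (cases "x < 2 ^ d \<and> 2 ^ d \<le> y")
  case True
  then show ?thesis
    using cube_op_less_iff[OF assms, of x] by (simp add: cube_op_def)
next
  case False
  then show ?thesis by (auto simp: cube_op_def)
qed

lemma cube_op_closed:
  assumes "x \<in> cube_points d" "y \<in> cube_points d"
  shows "cube_op d x y \<in> cube_points d"
proof (cases "x < 2 ^ d")
  case True
  then show ?thesis
    using cube_op_less_iff[OF assms(2), of x] by (simp add: cube_points_def)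
next
  case False
  then show ?thesis using assms by (simp add: cube_op_def)
qed

lemma kei_cube:
  assumes "d \<ge> 1"
  shows "kei (cube_points d) (cube_op d)"
proof
  show "cube_points d \<noteq> {}"
    using assms by (auto simp: cube_points_def lessThan_empty_iff)
next
  fix x y assume "x \<in> cube_points d" "y \<in> cube_points d"
  then show "cube_op d x y \<in> cube_points d" by (rule cube_op_closed)
next
  fix y assume "y \<in> cube_points d"
  then show "bij_betw (\<lambda>x. cube_op d x y) (cube_points d) (cube_points d)"
    by (intro bij_betw_byWitness[where f' = "\<lambda>x. cube_op d x y"]) (auto simp: cube_op_closed)
next
  fix x y z assume xyz: "x \<in> cube_points d" "y \<in> cube_points d" "z \<in> cube_points d"
  show "cube_op d (cube_op d x y) z = cube_op d (cube_op d x z) (cube_op d y z)"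
  \<comment> \<open>If \<open>y\<close> lies in the cube, so does its image under \<open>z\<close>;
    both act trivially, and each side is \<open>cube_op d x z\<close>. Otherwise \<open>z\<close>
    fixes \<open>y\<close>, and it remains to see that the actions of \<open>y\<close> and
    \<open>z\<close> on \<open>x\<close> commute.\<close>
  proof (cases "y < 2 ^ d")
    case True
    then have "cube_op d y z < 2 ^ d"
      using xyz by (simp add: cube_op_less_iff)
    with True show ?thesis by (simp add: cube_op_def)
  next
    case False
    then have "cube_op d y z = y" by (simp add: cube_op_def)
    moreover have "cube_op d (cube_op d x y) z = cube_op d (cube_op d x z) y"
      using cube_op_less_iff[of y d x] cube_op_less_iff[of z d x] xyz
      by (auto simp: cube_op_def flip_bit_commute)
    ultimately show ?thesis by simp
  qed
next
  fix x assume "x \<in> cube_points d"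
  show "cube_op d x x = x" by (simp add: cube_op_def)
next
  fix x y assume "y \<in> cube_points d"
  then show "cube_op d (cube_op d x y) y = x" by simp
qed

section \<open>Edges and adjacency\<close>

lemma vertices_cube_graph: "vertices (cube_graph d) = {..<2 ^ d}"
  by (auto simp: induced_subgraph_def kei_graph_def cube_points_def)

lemma edges_kei_cube:
  "edges (kei_graph (cube_points d) (cube_op d)) =
    {(2 ^ d + i, {u, flip_bit i u}) | i u. i < d \<and> u < 2 ^ d}" (is "?E = ?F")
proof (intro set_eqI iffI)
  fix e assume "e \<in> ?E"
  then obtain y u where *: "e = (y, {u, cube_op d u y})" "y \<in> cube_points d" "u \<noteq> cube_op d u y"
    by (auto simp: kei_graph_def)
  then have "u < 2 ^ d" "2 ^ d \<le> y"
    by (auto simp: cube_op_def split: if_splits)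
  then show "e \<in> ?F"
    using * by (intro CollectI exI[of _ "y - 2 ^ d"] exI[of _ u]) (auto simp: cube_op_def cube_points_def)
next
  fix e assume "e \<in> ?F"
  then obtain i u where *: "e = (2 ^ d + i, {u, flip_bit i u})" "i < d" "u < 2 ^ d"
    by auto
  have "cube_op d u (2 ^ d + i) = flip_bit i u"
    using * by (simp add: cube_op_def)
  moreover have "flip_bit i u \<in> cube_points d" "u \<in> cube_points d" "2 ^ d + i \<in> cube_points d"
    using * flip_bit_less_exp[of u d i] by (auto simp: cube_points_def)
  ultimately show "e \<in> ?E"
    using * flip_bit_neq[of i u] by (auto simp: kei_graph_def simp del: flip_bit_neq)
qed

text \<open>Only cube points are ever moved, and they stay in the cube, so restricting to the cube
  loses no edge. Adjacency is therefore the same in both graphs, and one characterisation serves for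
  the component and for the diameter.\<close>

lemma edges_cube_graph: "edges (cube_graph d) = edges (kei_graph (cube_points d) (cube_op d))"
  unfolding induced_subgraph_def
  by (auto simp: edges_kei_cube intro: flip_bit_less_exp)

lemma adjacent_kei_cube_iff:
  "adjacent (kei_graph (cube_points d) (cube_op d)) u v \<longleftrightarrow>
    u < 2 ^ d \<and> (\<exists>i<d. v = flip_bit i u)" (is "adjacent ?G u v \<longleftrightarrow> ?R")
proof
  assume "adjacent ?G u v"
  then obtain i w where i: "i < d" "w < 2 ^ d" "{u, v} = {w, flip_bit i w}"
    by (auto simp: adjacent_def edges_kei_cube)
  then consider "u = w" "v = flip_bit i w" | "u = flip_bit i w" "v = w"
    by (auto simp: doubleton_eq_iff)
  then show ?R
  proof cases
    case 1
    with i show ?thesis by blast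
  next
    case 2
    then have "v = flip_bit i u" by simp
    moreover have "u < 2 ^ d" using 2 i by (simp add: flip_bit_less_exp)
    ultimately show ?thesis using i by blast
  qed
next
  assume ?R
  then obtain i where i: "i < d" "u < 2 ^ d" "v = flip_bit i u" by blast
  then have "2 ^ d + i \<in> colours ?G" "(2 ^ d + i, {u, v}) \<in> edges ?G"
    unfolding edges_kei_cube by (auto simp: kei_graph_def cube_points_def)
  then show "adjacent ?G u v" unfolding adjacent_def ..
qed

lemma adjacent_cube_graph:
  "adjacent (cube_graph d) = adjacent (kei_graph (cube_points d) (cube_op d))"
  unfolding adjacent_def edges_cube_graph by (simp add: induced_subgraph_def)

lemmas adjacent_cube_graph_iff = adjacent_kei_cube_iff[folded adjacent_cube_graph]

section \<open>Walks in the cube\<close>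

text \<open>No edge leaves the cube. This bounds the component of 0 from above.\<close>

lemma walk_kei_cube_less:
  assumes "successively (adjacent (kei_graph (cube_points d) (cube_op d))) p" "p \<noteq> []"
    "hd p < 2 ^ d"
  shows "last p < 2 ^ d"
  using assms
proof (induction p rule: induct_list012)
  case (3 x y p)
  then show ?case by (auto simp: adjacent_kei_cube_iff flip_bit_less_exp)
qed auto

text \<open>Bits are corrected one at a time from the top down, with at most one edge for each of
  the \<open>n\<close> lowest bits. The bound is \<open>Suc n\<close> because
  \<open>length p\<close> counts vertices. The start \<open>u\<close> must be arbitrary in the
  induction, since correcting a bit moves it.\<close>

lemma walk_cube_graph_exists:
  assumes "u < 2 ^ d" "v < 2 ^ d" "n \<le> d" "\<And>i. i \<ge> n \<Longrightarrow> bit u i = bit v i"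
  shows "\<exists>p. walk_between (cube_graph d) u p v \<and> length p \<le> Suc n"
  using assms
proof (induction n arbitrary: u)
  case 0
  then have "u = v" by (auto simp: bit_eq_iff)
  with 0 have "walk_between (cube_graph d) u [u] v"
    by (simp add: walk_between_def vertices_cube_graph)
  then show ?case by (intro exI[of _ "[u]"]) simp
next
  case (Suc n)
  show ?case
  \<comment> \<open>If bit \<open>n\<close> already agrees, the walk for \<open>n\<close> serves
    unchanged; otherwise an edge in direction \<open>n\<close> is put in front of it.\<close>
  proof (cases "bit u n = bit v n")
    case True
    then have "bit u i = bit v i" if "i \<ge> n" for i
      using that Suc.prems(4)[of i] by (cases "i = n") auto
    then show ?thesis
      using Suc.IH[of u] Suc.prems by force
  next
    case False
    have "bit (flip_bit n u) i = bit v i" if "i \<ge> n" for i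
      using that False Suc.prems(4)[of i] by (cases "i = n") (auto simp: bit_flip_bit_iff)
    moreover have "flip_bit n u < 2 ^ d"
      using Suc.prems by (simp add: flip_bit_less_exp)
    ultimately obtain p where p: "walk_between (cube_graph d) (flip_bit n u) p v" "length p \<le> Suc n"
      using Suc.IH[of "flip_bit n u"] Suc.prems by auto
    moreover have "adjacent (cube_graph d) u (flip_bit n u)"
      using Suc.prems by (auto simp: adjacent_cube_graph_iff intro!: exI[of _ n])
    ultimately have "walk_between (cube_graph d) u (u # p) v"
      using Suc.prems by (auto simp: walk_between_def vertices_cube_graph successively_Cons)
    with p(2) show ?thesis by (intro exI[of _ "u # p"]) simp
  qed
qed

text \<open>This is the case \<open>n = d\<close>: beyond position \<open>d\<close> all bits of both
  ends are clear and hence agree.\<close>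

lemma walk_cube_graph_exists_le:
  assumes "u < 2 ^ d" "v < 2 ^ d"
  obtains p where "walk_between (cube_graph d) u p v" "length p \<le> Suc d"
  using walk_cube_graph_exists[OF assms order.refl] assms by (auto simp: nat_less_exp_iff_bit)

section \<open>Hamming weight as a lower bound for distances\<close>

text \<open>Since \<open>n < 2 ^ n\<close>, every set bit has a position below \<open>n\<close>.
  Finiteness makes \<open>card\<close> of this set a genuine Hamming weight.\<close>

lemma finite_bits_nat: "finite {i. bit (n :: nat) i}"
proof (rule finite_subset)
  have "\<forall>i\<ge>n. \<not> bit n i"
    using less_exp[of n] nat_less_exp_iff_bit by blast
  then show "{i. bit n i} \<subseteq> {..<n}"
    by (metis lessThan_iff mem_Collect_eq not_le subsetI)
qed simp

lemma card_bits_flip_bit_le: "card {i. bit (flip_bit j n) i} \<le> Suc (card {i. bit n i})" for n :: nat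
proof -
  have "card {i. bit (flip_bit j n) i} \<le> card (insert j {i. bit n i})"
    by (rule card_mono) (auto simp: bit_flip_bit_iff finite_bits_nat)
  also have "\<dots> \<le> Suc (card {i. bit n i})"
    by (simp add: card_insert_if finite_bits_nat)
  finally show ?thesis .
qed

text \<open>Each edge flips one bit and so raises the Hamming weight by at most one;
  \<open>length p - 1\<close> is the number of edges.\<close>

lemma card_bits_le_walk:
  assumes "successively (adjacent (cube_graph d)) p" "p \<noteq> []"
  shows "card {i. bit (last p) i} \<le> card {i. bit (hd p) i} + (length p - 1)"
  using assms
proof (induction p rule: induct_list012)
  case (3 x y p)
  then obtain j where "y = flip_bit j x"
    by (auto simp: adjacent_cube_graph_iff)
  then have "card {i. bit y i} \<le> Suc (card {i. bit x i})"
    by (simp add: card_bits_flip_bit_le)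
  with 3 show ?case by simp
qed auto

section \<open>The component and its diameter\<close>

lemma graph_component_cube:
  "graph_component (kei_graph (cube_points d) (cube_op d)) {..<2 ^ d}"
proof -
  let ?G = "kei_graph (cube_points d) (cube_op d)"
  have "\<exists>p. walk_between ?G 0 p v" if v: "v < 2 ^ d" for v
  proof -
    obtain p where "walk_between (cube_graph d) 0 p v"
      using walk_cube_graph_exists_le[of 0 d v] v by auto
    then have "walk_between ?G 0 p v"
      unfolding walk_between_def adjacent_cube_graph
      by (auto simp: induced_subgraph_def)
    then show ?thesis ..
  qed
  moreover have "v < 2 ^ d" if "walk_between ?G 0 p v" for p v
    using that walk_kei_cube_less[of d p] by (auto simp: walk_between_def)
  ultimately have "{..<2 ^ d} = {v. \<exists>p. walk_between ?G 0 p v}"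
    by auto
  moreover have "0 \<in> vertices ?G"
    by (simp add: kei_graph_def cube_points_def)
  ultimately show ?thesis
    unfolding graph_component_def by blast
qed

lemma graph_diameter_cube: "graph_diameter (cube_graph d) = enat d"
proof (rule antisym)
  have "graph_distance (cube_graph d) u v \<le> enat d" if uv: "u < 2 ^ d" "v < 2 ^ d" for u v
  proof -
    obtain p where "walk_between (cube_graph d) u p v" "length p \<le> Suc d"
      using walk_cube_graph_exists_le[OF uv] .
    then show ?thesis
      unfolding graph_distance_def by (intro INF_lower2[of p]) auto
  qed
  then show "graph_diameter (cube_graph d) \<le> enat d"
    unfolding graph_diameter_def vertices_cube_graph by (intro SUP_least) auto
next
  \<comment> \<open>\<open>w\<close> is the antipode of 0: all its \<open>d\<close> bits are set, so
    by Hamming weight a walk from 0 to \<open>w\<close> needs at least \<open>d\<close>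
    edges.\<close>
  define w :: nat where "w = mask d"
  have w: "w < 2 ^ d"
    by (auto simp: w_def nat_less_exp_iff_bit bit_mask_iff)
  have "{i. bit w i} = {..<d}"
    by (auto simp: w_def bit_mask_iff)
  then have "d \<le> length p - 1" if "walk_between (cube_graph d) 0 p w" for p
    using that card_bits_le_walk[of d p] by (simp add: walk_between_def)
  then have "enat d \<le> graph_distance (cube_graph d) 0 w"
    unfolding graph_distance_def by (intro INF_greatest) simp
  also have "\<dots> \<le> graph_diameter (cube_graph d)"
    unfolding graph_diameter_def vertices_cube_graph
    using w by (intro SUP_upper2[of 0] SUP_upper) auto
  finally show "enat d \<le> graph_diameter (cube_graph d)" .
qed

section \<open>Counting the edges of each colour\<close>

lemma card_edges_of_direction:
  assumes "i < d"
  shows "card (edges_of_colour (cube_graph d) (2 ^ d + i)) = 2 ^ (d - 1)"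
proof -
  let ?A = "{u :: nat. u < 2 ^ d \<and> \<not> bit u i}" and ?f = "\<lambda>u. (2 ^ d + i, {u, flip_bit i u})"
  have "edges_of_colour (cube_graph d) (2 ^ d + i) = ?f ` {..<2 ^ d}"
    using assms by (auto simp: edges_of_colour_def edges_cube_graph edges_kei_cube)
  \<comment> \<open>Each edge arises from both of its endpoints. Exactly one of them has bit
    \<open>i\<close> clear, and choosing that one makes \<open>?f\<close> injective.\<close>
  also have "\<dots> = ?f ` ?A"
  proof (intro set_eqI iffI)
    fix e :: "nat \<times> nat set" assume "e \<in> ?f ` {..<2 ^ d}"
    then obtain u where u: "e = ?f u" "u < 2 ^ d" by auto
    show "e \<in> ?f ` ?A"
    proof (cases "bit u i")
      case True
      then have "e = ?f (flip_bit i u)" "flip_bit i u \<in> ?A"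
        using u assms by (auto simp: flip_bit_less_exp bit_flip_bit_iff)
      then show ?thesis by blast
    next
      case False
      then show ?thesis using u by auto
    qed
  qed auto
  also have "card \<dots> = card ?A"
    by (intro card_image inj_onI) (auto simp: doubleton_eq_iff bit_flip_bit_iff)
  finally show ?thesis
    using card_less_exp_not_bit[OF assms] by simp
qed

lemma Max_card_edges_cube:
  assumes "d \<ge> 1"
  shows "Max ((\<lambda>k. card (edges_of_colour (cube_graph d) k)) ` cube_points d) = 2 ^ (d - 1)"
proof (rule Max_eqI)
  show "finite ((\<lambda>k. card (edges_of_colour (cube_graph d) k)) ` cube_points d)"
    by (simp add: cube_points_def)
next
  fix m assume "m \<in> (\<lambda>k. card (edges_of_colour (cube_graph d) k)) ` cube_points d"
  then obtain k where k: "k < 2 ^ d + d" "m = card (edges_of_colour (cube_graph d) k)"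
    by (auto simp: cube_points_def)
  show "m \<le> 2 ^ (d - 1)"
  proof (cases "k < 2 ^ d")
    case True
    then have "edges_of_colour (cube_graph d) k = {}"
      by (auto simp: edges_of_colour_def edges_cube_graph edges_kei_cube)
    then show ?thesis using k by simp
  next
    case False
    then show ?thesis
      using k card_edges_of_direction[of "k - 2 ^ d" d] by simp
  qed
next
  \<comment> \<open>The maximum is attained at the colour \<open>2 ^ d\<close>, which is direction
    0; this direction exists because \<open>d \<ge> 1\<close>.\<close>
  show "2 ^ (d - 1) \<in> (\<lambda>k. card (edges_of_colour (cube_graph d) k)) ` cube_points d"
    using assms card_edges_of_direction[of 0 d]
    by (intro image_eqI[of _ _ "2 ^ d"]) (auto simp: cube_points_def)
qed

theorem mainTheorem2:
  fixes d :: nat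
  assumes "d \<ge> 1"
  shows "\<exists>(X :: nat set) (op :: nat \<Rightarrow> nat \<Rightarrow> nat).
    kei X op \<and> finite X \<and>
    (\<exists>C. graph_component (kei_graph X op) C \<and>
      graph_diameter (induced_subgraph (kei_graph X op) C) = enat d \<and>
      card C = 2 ^ d \<and>
      Max ((\<lambda>k. card (edges_of_colour (induced_subgraph (kei_graph X op) C) k)) ` X) = 2 ^ (d - 1))"
  using kei_cube[OF assms] graph_component_cube graph_diameter_cube Max_card_edges_cube[OF assms]
  by (intro exI[of _ "cube_points d"] exI[of _ "cube_op d"] conjI exI[of _ "{..<2 ^ d}"])
    (auto simp: cube_points_def)

end
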